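(* For all integers $k, n$ with $2\leq k\leq n$, we have $$|S_n^{(k)}(213)|=|S_n^{(k)}(231)|=|S_n^{(k)}(312)|=|S_n^{(k)}(132)|=k-2+\sum_{i=0}^{n-k+1}C_i,$$ where $C_i=\frac{1}{i+1}\binom{2i}{i}$ is the $i$th Catalan number.
   Context: $S_n$ denotes the set of permutations $p=p(1)p(2)\cdots p(n)$ of $\{1,2,\ldots,n\}$ in one-line notation. For $p\in S_n$ and $q\in S_m$, $p$ contains $q$ as a pattern if there exist $1\leq i_1<\cdots<i_m\leq n$ such that for all $1\leq a<b\leq m$, $p(i_a)<p(i_b)$ if and only if $q(a)<q(b)$; otherwise $p$ avoids $q$. The rotations of $p\in S_n$ are $p^{(1)}=p$ and, for $i\in\{2,\ldots,n\}$, $p^{(i)}=p(i)p(i+1)\cdots p(n)p(1)p(2)\cdots p(i-1)$. For a pattern $q$, $S_n^{(k)}(q)$ is the set of $p\in S_n$ such that $p^{(i)}$ avoids $q$ for all $i\in\{1,2,\ldots,k\}$. *)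

theory Defs
  imports Complex_Main "HOL-Combinatorics.Multiset_Permutations"
begin

text \<open>Permutations of \<open>{1..n}\<close> are in one-line notation, as elements of
  \<open>permutations_of_set {1..n}\<close>. List positions are counted from 0, so \<open>p ! i\<close> stands for
  \<open>p(i + 1)\<close>.\<close>

definition contains_pattern :: "nat list \<Rightarrow> nat list \<Rightarrow> bool" where
  "contains_pattern p q \<longleftrightarrow>
     (\<exists>f :: nat \<Rightarrow> nat. strict_mono_on {..<length q} f \<and> f ` {..<length q} \<subseteq> {..<length p} \<and>
        (\<forall>a b. a < b \<and> b < length q \<longrightarrow> (p ! f a < p ! f b \<longleftrightarrow> q ! a < q ! b)))"

definition avoids_pattern :: "nat list \<Rightarrow> nat list \<Rightarrow> bool" where
  "avoids_pattern p q \<longleftrightarrow> \<not> contains_pattern p q"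

definition rotation :: "nat \<Rightarrow> nat list \<Rightarrow> nat list" where
  "rotation i p = rotate (i - 1) p"

definition rotation_avoiders :: "nat \<Rightarrow> nat \<Rightarrow> nat list \<Rightarrow> nat list set" where
  "rotation_avoiders n k q =
     {p \<in> permutations_of_set {1..n}. \<forall>i\<in>{1..k}. avoids_pattern (rotation i p) q}"

definition catalan :: "nat \<Rightarrow> real" where
  "catalan i = 1 / (real i + 1) * real ((2 * i) choose i)"

end

theory Submission
  imports Defs "HOL-Computational_Algebra.Formal_Power_Series"
begin

text \<open>Reversal (combined with a rotation by \<open>k - 1\<close>) and complementation reduce the four patterns to
  231. Rotating \<open>x # xs\<close> to \<open>xs @ [x]\<close> keeps a 231-avoider \<open>x # xs\<close> of \<open>{1..n}\<close> a 231-avoider iff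
  \<open>xs\<close> consists of an arrangement of \<open>{1..x - 1}\<close> followed by \<open>n, \<dots>, x + 1\<close>. Iterating this, the
  final rotations \<open>p\<^sup>(\<^sup>k\<^sup>)\<close> are exactly the lists \<open>t, n, n - 1, \<dots>, m + 1\<close> where \<open>m \<le> n - k + 1\<close> and \<open>t\<close> is
  a 231-avoider of \<open>{1..m}\<close>, together with \<open>k - 2\<close> further rotations of the decreasing permutation.\<close>

section \<open>Symmetries\<close>

text \<open>An occurrence read backwards is an occurrence of the reversed pattern. Distinctness is
  what lets each comparison be turned around: without ties, the negation of \<open><\<close> is
  \<open>>\<close>.\<close>

lemma contains_pattern_rev:
  assumes "contains_pattern p q" "distinct p" "distinct q"
  shows "contains_pattern (rev p) (rev q)"
proof -
  obtain f where f: "strict_mono_on {..<length q} f" "f ` {..<length q} \<subseteq> {..<length p}"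
    "\<And>a b. a < b \<Longrightarrow> b < length q \<Longrightarrow> p ! f a < p ! f b \<longleftrightarrow> q ! a < q ! b"
    using assms(1) unfolding contains_pattern_def by blast
  have less: "f a < f b" if "a < b" "b < length q" for a b
    using f(1) that by (auto simp: strict_mono_on_def)
  have bound: "f a < length p" if "a < length q" for a
    using f(2) that by auto
  \<comment> \<open>Positions are mirrored in both lists: index \<open>a\<close> of
    \<open>rev q\<close> is index \<open>length q - Suc a\<close> of \<open>q\<close>, and its image
    under \<open>f\<close> is mirrored back into \<open>rev p\<close>.\<close>
  define g where "g = (\<lambda>a. length p - Suc (f (length q - Suc a)))"
  have idx: "length q - Suc b < length q - Suc a" "length q - Suc a < length q"
    if "a < b" "b < length q" for a b using that by auto
  have "strict_mono_on {..<length q} g"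
    unfolding strict_mono_on_def
  proof (intro allI impI, elim conjE)
    fix a b assume "a \<in> {..<length q}" "b \<in> {..<length q}" "a < b"
    then have "length q - Suc b < length q - Suc a" "length q - Suc a < length q"
      using idx by simp_all
    then show "g a < g b"
      using less[of "length q - Suc b" "length q - Suc a"] bound[of "length q - Suc a"]
      unfolding g_def by linarith
  qed
  moreover have "g ` {..<length q} \<subseteq> {..<length p}"
    using bound by (force simp: g_def)
  moreover have "rev p ! g a < rev p ! g b \<longleftrightarrow> rev q ! a < rev q ! b"
    if ab: "a < b" "b < length q" for a b
  proof -
    let ?a = "length q - Suc a" and ?b = "length q - Suc b"
    have i: "?b < ?a" "?a < length q" using idx[OF ab] by auto
    have p: "rev p ! g c = p ! f (length q - Suc c)" if "c < length q" for c
    proof -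
      have "f (length q - Suc c) < length p" using bound that by simp
      then show ?thesis by (simp add: g_def rev_nth)
    qed
    have "p ! f ?b \<noteq> p ! f ?a"
      using less[OF i] bound[OF i(2)] assms(2) by (simp add: nth_eq_iff_index_eq)
    moreover have "q ! ?b \<noteq> q ! ?a"
      using i assms(3) by (simp add: nth_eq_iff_index_eq)
    ultimately show ?thesis
      using f(3)[OF i] ab p[of a] p[of b] by (auto simp: rev_nth)
  qed
  ultimately show ?thesis unfolding contains_pattern_def by (auto intro!: exI[of _ g])
qed

text \<open>The same positions \<open>f\<close> serve, since order reversal on both sides flips
  every comparison twice. Going from the images back to the originals is the direction that carries
  avoidance over to the complements.\<close>

lemma contains_pattern_map_antimono:
  assumes "contains_pattern (map g p) (map h q)" "distinct p" "distinct q"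
    and g: "\<And>x y. x \<in> set p \<Longrightarrow> y \<in> set p \<Longrightarrow> g x < g y \<longleftrightarrow> y < (x :: nat)"
    and h: "\<And>x y. x \<in> set q \<Longrightarrow> y \<in> set q \<Longrightarrow> h x < h y \<longleftrightarrow> y < (x :: nat)"
  shows "contains_pattern p q"
proof -
  obtain f where f: "strict_mono_on {..<length q} f" "f ` {..<length q} \<subseteq> {..<length p}"
    "\<And>a b. a < b \<Longrightarrow> b < length q \<Longrightarrow> map g p ! f a < map g p ! f b \<longleftrightarrow> map h q ! a < map h q ! b"
    using assms(1) unfolding contains_pattern_def by auto
  have "p ! f a < p ! f b \<longleftrightarrow> q ! a < q ! b" if ab: "a < b" "b < length q" for a b
  proof -
    have b: "f a < length p" "f b < length p"
      using f(2) ab by (auto simp: image_subset_iff)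
    have "f a < f b" using f(1) ab by (simp add: strict_mono_on_def)
    with b    have "p ! f a \<noteq> p ! f b" using b assms(2) by (simp add: nth_eq_iff_index_eq)
    moreover have "q ! a \<noteq> q ! b" using ab assms(3) by (simp add: nth_eq_iff_index_eq)
    ultimately show ?thesis using f(3)[OF ab] b ab g[of "p ! f a" "p ! f b"] h[of "q ! a" "q ! b"]
      by auto
  qed
  then show ?thesis unfolding contains_pattern_def using f(1,2) by blast
qed

section \<open>Reversal and complementation as maps between sets of rotation avoiders\<close>

lemma finite_rotation_avoiders: "finite (rotation_avoiders n k q)"
  unfolding rotation_avoiders_def by simp

lemma rotation_avoiders_iff:
  "p \<in> rotation_avoiders n k q \<longleftrightarrow>
     p \<in> permutations_of_set {1..n} \<and> (\<forall>i<k. avoids_pattern (rotate i p) q)"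
proof -
  have "{1..k} = Suc ` {..<k}"
    by (simp add: lessThan_atLeast0 image_Suc_atLeastLessThan atLeastLessThanSuc_atLeastAtMost)
  then show ?thesis by (auto simp: rotation_avoiders_def rotation_def)
qed

lemma rotate1_rev_rotate1: "rotate1 (rev (rotate1 xs)) = rev xs"
  by (cases xs) auto

text \<open>Reversal conjugates a rotation into its inverse, so the two rotations cancel.\<close>

lemma rotate_rev_rotate: "rotate j (rev (rotate j xs)) = rev xs"
proof (induction j arbitrary: xs)
  case (Suc j)
  have "rotate (Suc j) (rev (rotate (Suc j) xs)) = rotate1 (rotate j (rev (rotate j (rotate1 xs))))"
    by (simp add: rotate1_rotate_swap)
  also have "\<dots> = rev xs" by (simp only: Suc rotate1_rev_rotate1)
  finally show ?case .
qed simp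

lemma inj_rotate: "inj (rotate m)"
  by (metis injI rotate_rev_rotate rev_rev_ident)

text \<open>Reversing the last of the \<open>k\<close> rotations makes the window of rotations run
  backwards: rotation \<open>i\<close> of the image is the reversal of rotation
  \<open>k - 1 - i\<close> of \<open>p\<close>. An inequality suffices, because applying it to
  \<open>rev q\<close> gives the converse.\<close>

lemma card_rotation_avoiders_rev_le:
  assumes "distinct q"
  shows "card (rotation_avoiders n k q) \<le> card (rotation_avoiders n k (rev q))"
proof (rule card_inj_on_le)
  let ?f = "\<lambda>p. rev (rotate (k - 1) p)"
  show "inj_on ?f (rotation_avoiders n k q)"
    using inj_rotate by (auto simp: inj_on_def)
  show "?f ` rotation_avoiders n k q \<subseteq> rotation_avoiders n k (rev q)"
  proof (clarify, unfold rotation_avoiders_iff, intro conjI allI impI)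
    fix p i
    assume p: "p \<in> permutations_of_set {1..n} \<and> (\<forall>i<k. avoids_pattern (rotate i p) q)"
    then show "?f p \<in> permutations_of_set {1..n}" by (auto simp: permutations_of_set_def)
    assume "i < k"
    then have "rotate (k - 1) p = rotate i (rotate (k - 1 - i) p)" by (simp add: rotate_rotate)
    then have "rotate i (?f p) = rev (rotate (k - 1 - i) p)" by (simp only: rotate_rev_rotate)
    moreover have "avoids_pattern (rev (rotate (k - 1 - i) p)) (rev q)"
    proof -
      have "avoids_pattern (rotate (k - 1 - i) p) q" using p \<open>i < k\<close> by simp
      then show ?thesis
        using contains_pattern_rev[of "rev (rotate (k - 1 - i) p)" "rev q"] p assms
        by (auto simp: avoids_pattern_def permutations_of_set_def)
    qed
    ultimately show "avoids_pattern (rotate i (?f p)) (rev q)" by simp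
  qed
qed (rule finite_rotation_avoiders)

lemma card_rotation_avoiders_rev:
  assumes "distinct q"
  shows "card (rotation_avoiders n k (rev q)) = card (rotation_avoiders n k q)"
  using card_rotation_avoiders_rev_le[of q n k] card_rotation_avoiders_rev_le[of "rev q" n k] assms
  by simp

text \<open>Complementing entries commutes with rotating, so all \<open>k\<close> rotations are
  complemented at once. The bound \<open>m\<close> on the pattern keeps the truncated subtraction
  strictly order-reversing.\<close>

lemma card_rotation_avoiders_complement_le:
  assumes "distinct q" "set q \<subseteq> {..m}"
  shows "card (rotation_avoiders n k q) \<le> card (rotation_avoiders n k (map (\<lambda>x. m - x) q))"
proof (rule card_inj_on_le)
  let ?c = "\<lambda>x. Suc n - x" and ?q = "map (\<lambda>x. m - x) q"
  have inj: "inj_on ?c {1..n}" by (auto simp: inj_on_def)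
  show "inj_on (map ?c) (rotation_avoiders n k q)"
    by (rule inj_onI, rule map_inj_on, assumption)
      (auto simp: rotation_avoiders_def permutations_of_set_def inj_on_def)
  show "map ?c ` rotation_avoiders n k q \<subseteq> rotation_avoiders n k ?q"
  proof (clarify, unfold rotation_avoiders_iff, intro conjI allI impI)
    fix p i
    assume p: "p \<in> permutations_of_set {1..n} \<and> (\<forall>i<k. avoids_pattern (rotate i p) q)"
    \<comment> \<open>An injective self-map of a finite set is onto.\<close>
    have "?c ` {1..n} = {1..n}"
      by (rule endo_inj_surj) (use inj in auto)
    then show "map ?c p \<in> permutations_of_set {1..n}"
      using p inj by (auto simp: permutations_of_set_def distinct_map)
    assume "i < k"
    then have "avoids_pattern (rotate i p) q" using p by simp
    moreover have "contains_pattern (rotate i p) q" if "contains_pattern (map ?c (rotate i p)) ?q"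
      using that
    proof (rule contains_pattern_map_antimono)
      show "m - x < m - y \<longleftrightarrow> y < x" if "x \<in> set q" "y \<in> set q" for x y
      proof -
        have "x \<le> m" "y \<le> m" using that assms(2) by auto
        then show ?thesis by linarith
      qed
      show "?c x < ?c y \<longleftrightarrow> y < x" if "x \<in> set (rotate i p)" "y \<in> set (rotate i p)" for x y
      proof -
        have "x \<le> n" "y \<le> n" using that p by (auto simp: permutations_of_set_def)
        then show ?thesis by linarith
      qed
    qed (use p assms in \<open>auto simp: permutations_of_set_def\<close>)
    ultimately show "avoids_pattern (rotate i (map ?c p)) ?q"
      by (auto simp: avoids_pattern_def rotate_map)
  qed
qed (rule finite_rotation_avoiders)

lemma card_rotation_avoiders_complement:
  assumes "distinct q" "set q \<subseteq> {..m}"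
  shows "card (rotation_avoiders n k (map (\<lambda>x. m - x) q)) = card (rotation_avoiders n k q)"
proof -
  have "map (\<lambda>x. m - x) (map (\<lambda>x. m - x) q) = q"
    using assms(2) by (auto intro!: map_idI)
  moreover have "distinct (map (\<lambda>x. m - x) q)"
    using assms by (auto simp: distinct_map inj_on_def subset_iff) (metis diff_diff_cancel)
  ultimately show ?thesis
    using card_rotation_avoiders_complement_le[OF assms, of n k]
      card_rotation_avoiders_complement_le[of "map (\<lambda>x. m - x) q" m n k]
    by (simp add: image_subset_iff)
qed

section \<open>Lists avoiding 231\<close>

text \<open>Recursion on the entry \<open>x\<close> that would play the \<open>2\<close>: nothing
  above \<open>x\<close> may be followed by something not above \<open>x\<close>.\<close>

fun avoids231 :: "nat list \<Rightarrow> bool" where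
  "avoids231 [] \<longleftrightarrow> True"
| "avoids231 (x # xs) \<longleftrightarrow> avoids231 xs \<and> sorted_wrt (\<lambda>y z. x < y \<longrightarrow> x < z) xs"

lemma avoids231_iff_nth:
  "avoids231 p \<longleftrightarrow> (\<forall>i j l. i < j \<and> j < l \<and> l < length p \<and> p ! i < p ! j \<longrightarrow> p ! i < p ! l)"
proof (induction p)
  case (Cons x xs)
  show ?case (is "?L \<longleftrightarrow> (\<forall>i j l. ?R i j l)")
  proof
    assume L: ?L
    show "\<forall>i j l. ?R i j l"
    proof (intro allI impI)
      fix i j l
      assume h: "i < j \<and> j < l \<and> l < length (x # xs) \<and> (x # xs) ! i < (x # xs) ! j"
      then obtain j' l' where [simp]: "j = Suc j'" "l = Suc l'"
        by (metis less_nat_zero_code not0_implies_Suc)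
      show "(x # xs) ! i < (x # xs) ! l"
        using L h Cons.IH by (cases i) (auto simp: sorted_wrt_iff_nth_less)
    qed
  next
    assume R: "\<forall>i j l. ?R i j l"
    have "\<forall>i j l. i < j \<and> j < l \<and> l < length xs \<and> xs ! i < xs ! j \<longrightarrow> xs ! i < xs ! l"
      using R[rule_format, of "Suc _" "Suc _" "Suc _"] by auto
    moreover have "sorted_wrt (\<lambda>y z. x < y \<longrightarrow> x < z) xs"
      unfolding sorted_wrt_iff_nth_less using R[rule_format, of 0 "Suc _" "Suc _"] by auto
    ultimately show ?L using Cons.IH by simp
  qed
qed simp

text \<open>Only the comparisons of the first entry with the other two have to be tested; the one
  between the second and the third then follows by transitivity.\<close>

lemma avoids_pattern_231: "avoids_pattern p [2, 3, 1] \<longleftrightarrow> avoids231 p"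
proof -
  have "contains_pattern p [2, 3, 1] \<longleftrightarrow>
    (\<exists>i j l. i < j \<and> j < l \<and> l < length p \<and> p ! i < p ! j \<and> \<not> p ! i < p ! l)" (is "?L \<longleftrightarrow> ?R")
  proof
    assume ?L
    then obtain f where f: "strict_mono_on {..<3} f" "f ` {..<3} \<subseteq> {..<length p}"
      "\<And>a b. a < b \<Longrightarrow> b < 3 \<Longrightarrow> p ! f a < p ! f b \<longleftrightarrow> [2, 3, 1 :: nat] ! a < [2, 3, 1] ! b"
      unfolding contains_pattern_def by (auto simp: numeral_3_eq_3)
    have "f 0 < f 1" "f 1 < f 2"
      using f(1) by (auto simp: strict_mono_on_def)
    moreover have "f 2 < length p" using f(2) by (simp add: image_subset_iff)
    ultimately
    show ?R using f(3)[of 0 1] f(3)[of 0 2] by (auto simp: numeral_2_eq_2)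
  next
    assume ?R
    then obtain i j l where h: "i < j" "j < l" "l < length p" "p ! i < p ! j" "\<not> p ! i < p ! l"
      by blast
    then show ?L unfolding contains_pattern_def
      by (intro exI[of _ "\<lambda>a. [i, j, l] ! a"])
        (auto simp: strict_mono_on_def less_Suc_eq numeral_3_eq_3 numeral_2_eq_2)
  qed
  then show ?thesis unfolding avoids_pattern_def avoids231_iff_nth by blast
qed

text \<open>No occurrence can straddle the two blocks: its last entry is its smallest, so if that
  lies in \<open>ys\<close>, the larger ones cannot lie in \<open>xs\<close>.\<close>

lemma avoids231_append:
  assumes "\<And>x y. x \<in> set xs \<Longrightarrow> y \<in> set ys \<Longrightarrow> x < y"
  shows "avoids231 (xs @ ys) \<longleftrightarrow> avoids231 xs \<and> avoids231 ys"
  using assms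
proof (induction xs)
  case (Cons x xs)
  have "sorted_wrt (\<lambda>y z. x < y \<longrightarrow> x < z) ys"
    using Cons.prems by (auto simp: sorted_wrt_iff_nth_less)
  then show ?case using Cons by (auto simp: sorted_wrt_append)
qed simp

lemma avoids231_snoc:
  "avoids231 (xs @ [b]) \<longleftrightarrow> avoids231 xs \<and> sorted_wrt (\<lambda>x y. x < y \<longrightarrow> x < b) xs"
  by (induction xs) (auto simp: sorted_wrt_append)

lemma avoids231_decreasing: "sorted_wrt (>) xs \<Longrightarrow> avoids231 xs"
proof (induction xs)
  case (Cons x xs)
  then have "sorted_wrt (\<lambda>y z. x < y \<longrightarrow> x < z) xs"
    by (auto intro!: sorted_wrt_mono_rel[of xs "(>)" "\<lambda>y z. x < y \<longrightarrow> x < z"])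
  then show ?case using Cons by simp
qed simp

section \<open>Decomposition of 231-avoiders by their first entry\<close>

definition avoiders231 :: "nat set \<Rightarrow> nat list set" where
  "avoiders231 S = {p \<in> permutations_of_set S. avoids231 p}"

lemma avoiders231_iff: "p \<in> avoiders231 S \<longleftrightarrow> set p = S \<and> distinct p \<and> avoids231 p"
  by (auto simp: avoiders231_def permutations_of_set_def)

lemma finite_avoiders231: "finite (avoiders231 S)"
  by (simp add: avoiders231_def)

text \<open>Once an entry above \<open>x\<close> has appeared, a later entry below \<open>x\<close>
  would complete a 231, so the smaller entries form a prefix.\<close>

lemma avoids231_Cons_split:
  assumes "avoids231 (x # xs)" "x \<notin> set xs"
  obtains l r where "xs = l @ r" "\<And>y. y \<in> set l \<Longrightarrow> y < x" "\<And>y. y \<in> set r \<Longrightarrow> x < y"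
proof -
  define l r where "l = takeWhile (\<lambda>y. y < x) xs" and "r = dropWhile (\<lambda>y. y < x) xs"
  have xs: "xs = l @ r" by (simp add: l_def r_def)
  have l: "y < x" if "y \<in> set l" for y using that by (auto simp: l_def dest: set_takeWhileD)
  have r: "x < y" if y: "y \<in> set r" for y
  proof (cases r)
    case (Cons z zs)
    have "\<not> z < x" using Cons r_def by (metis hd_dropWhile list.discI list.sel(1))
    moreover have "z \<noteq> x" using assms(2) xs Cons by auto
    ultimately have "x < z" by simp
    then show ?thesis using assms(1) y Cons xs by (auto simp: sorted_wrt_append)
  qed (use y in simp)
  show ?thesis using that xs l r by blast
qed

text \<open>The combinatorial Catalan recursion: the first entry \<open>l + i\<close> is followed by
  all smaller entries and then by all larger ones, each block an independent 231-avoider. Writing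
  intervals as start plus length prepares the induction on the length.\<close>

lemma avoiders231_interval_Suc:
  "avoiders231 {l..<l + Suc n} =
     (\<Union>i\<le>n. (\<lambda>(xs, ys). (l + i) # xs @ ys) `
       (avoiders231 {l..<l + i} \<times> avoiders231 {Suc (l + i)..<Suc (l + i) + (n - i)}))"
  (is "_ = (\<Union>i\<le>n. ?f i ` ?A i)")
proof (intro set_eqI iffI)
  fix p assume p: "p \<in> avoiders231 {l..<l + Suc n}"
  then obtain x xs where px: "p = x # xs" by (cases p) (auto simp: avoiders231_iff)
  have sp: "insert x (set xs) = {l..<l + Suc n}" "x \<notin> set xs" "distinct xs" "avoids231 (x # xs)"
    using p px by (auto simp: avoiders231_iff)
  obtain L R where xs: "xs = L @ R" and L: "\<And>y. y \<in> set L \<Longrightarrow> y < x" and R: "\<And>y. y \<in> set R \<Longrightarrow> x < y"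
    using avoids231_Cons_split sp(2,4) by blast
  have x: "l \<le> x" "x < l + Suc n" using sp(1) by auto
  have un: "set L \<union> set R = {l..<l + Suc n} - {x}" using sp xs by auto
  have sL: "set L = {y \<in> set L \<union> set R. y < x}" and sR: "set R = {y \<in> set L \<union> set R. x < y}"
    using L R by (auto dest: less_asym)
  have sL: "set L = {l..<x}"
    using x by (subst sL) (auto simp: un)
  have sR: "set R = {Suc x..<l + Suc n}"
    using x by (subst sR) (auto simp: un)
  have "avoids231 L \<and> avoids231 R"
  proof -
    have "avoids231 (L @ R)" using sp(4) xs by simp
    moreover have "x < y" if "x \<in> set L" "y \<in> set R" for x y
      using L[OF that(1)] R[OF that(2)] by (rule less_trans)
    ultimately show ?thesis using avoids231_append[of L R] by blast
  qed
  then have "(L, R) \<in> ?A (x - l)"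
    using sL sR x sp(3) xs by (auto simp: avoiders231_iff)
  moreover have "p = ?f (x - l) (L, R)" using px xs x by simp
  moreover have "x - l \<le> n" using x by simp
  ultimately show "p \<in> (\<Union>i\<le>n. ?f i ` ?A i)" by blast
next
  fix p assume "p \<in> (\<Union>i\<le>n. ?f i ` ?A i)"
  then obtain i L R where i: "i \<le> n" and p: "p = (l + i) # L @ R" and L: "L \<in> avoiders231 {l..<l + i}"
    and R: "R \<in> avoiders231 {Suc (l + i)..<Suc (l + i) + (n - i)}" by auto
  have sL: "set L = {l..<l + i}" and sR: "set R = {Suc (l + i)..<Suc (l + n)}"
    using L R i by (auto simp: avoiders231_iff)
  have "set p = {l..<l + Suc n}" using p sL sR i by auto
  moreover have "distinct p" using p sL sR L R by (auto simp: avoiders231_iff)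
  moreover have "avoids231 (L @ R)"
    using L R avoids231_append[of L R] sL sR by (auto simp: avoiders231_iff)
  moreover have "sorted_wrt (\<lambda>y z. l + i < y \<longrightarrow> l + i < z) (L @ R)"
  proof -
    have "\<not> l + i < L ! j" if "j < length L" for j using that sL nth_mem[of j L] by auto
    moreover have "l + i < R ! j" if "j < length R" for j using that sR nth_mem[of j R] by auto
    ultimately have "sorted_wrt (\<lambda>y z. l + i < y \<longrightarrow> l + i < z) L"
      "sorted_wrt (\<lambda>y z. l + i < y \<longrightarrow> l + i < z) R"
      by (simp_all add: sorted_wrt_iff_nth_less)
    then show ?thesis using sR by (auto simp: sorted_wrt_append)
  qed
  ultimately show "p \<in> avoiders231 {l..<l + Suc n}" using p by (simp add: avoiders231_iff)
qed

section \<open>Catalan numbers\<close>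

text \<open>The ratio of consecutive central binomial coefficients, from two absorption identities.
  It is the coefficient form of the differential equation used for the generating function
  below.\<close>

lemma catalan_Suc: "real (n + 2) * catalan (Suc n) = real (4 * n + 2) * catalan n"
proof -
  have "real ((2 * Suc n) choose Suc n) * (real n + 1) = real ((2 * n) choose n) * (4 * real n + 2)"
  proof -
    have a: "Suc n * (Suc (2 * n + 1) choose Suc n) = Suc (2 * n + 1) * ((2 * n + 1) choose n)"
      by (rule Suc_times_binomial)
    have b: "(Suc (2 * n) choose n) * (Suc (2 * n) - n) = Suc (2 * n) * ((2 * n) choose n)"
      using binomial_absorb_comp[of "Suc (2 * n)" n] by (simp add: mult.commute)
    have "Suc (2 * n) - n = Suc n" "2 * Suc n = Suc (2 * n + 1)" "2 * n + 1 = Suc (2 * n)" by simp_all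
    then have "Suc n * (Suc n * ((2 * Suc n) choose Suc n)) =
        Suc (2 * n + 1) * ((Suc (2 * n) choose n) * (Suc (2 * n) - n))"
      using a by (metis mult.assoc mult.commute)
    also have "\<dots> = Suc n * ((4 * n + 2) * ((2 * n) choose n))"
      unfolding b by (simp add: algebra_simps)
    finally have "Suc n * ((2 * Suc n) choose Suc n) = (4 * n + 2) * ((2 * n) choose n)"
      by (subst (asm) mult_cancel1) simp
    from arg_cong[OF this, of real] show ?thesis
      by (simp only: of_nat_mult of_nat_add of_nat_Suc) (simp add: algebra_simps)
  qed
  then have "real ((2 * Suc n) choose Suc n) =
      (4 * real n + 2) * (1 / (real n + 1) * real ((2 * n) choose n))"
    by (simp add: eq_divide_eq mult.commute del: binomial_Suc_Suc mult_Suc_right)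
  moreover have "real (n + 2) * catalan (Suc n) = real ((2 * Suc n) choose Suc n)"
    unfolding catalan_def by (simp only: of_nat_add of_nat_Suc) (simp add: add.commute)
  ultimately show ?thesis by (simp add: catalan_def)
qed

text \<open>With \<open>C\<close> the generating function, \<open>S = 1 - 2XC\<close> satisfies \<open>(1 - 4X)S' = -2S\<close>. Hence
  \<open>G = S\<^sup>2\<close> satisfies \<open>(1 - 4X)G' = -4G\<close>, which forces \<open>G = 1 - 4X\<close>, that is \<open>C = 1 + XC\<^sup>2\<close>.\<close>

lemma catalan_convolution: "catalan (Suc n) = (\<Sum>i\<le>n. catalan i * catalan (n - i))"
proof -
  define C where "C = Abs_fps catalan"
  define S where "S = 1 - fps_const 2 * (fps_X * C)"
  define G where "G = S * S"
  have c0: "catalan 0 = 1" by (simp add: catalan_def)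
  have S0: "fps_nth S 0 = 1" by (simp add: S_def)
  have SSuc: "fps_nth S (Suc m) = - 2 * catalan m" for m by (simp add: S_def C_def)
  have S': "(1 - fps_const 4 * fps_X) * fps_deriv S = - fps_const 2 * S"
  proof (rule fps_ext)
    fix m
    have "fps_nth ((1 - fps_const 4 * fps_X) * fps_deriv S) m
      = fps_nth (fps_deriv S) m - 4 * (if m = 0 then 0 else fps_nth (fps_deriv S) (m - 1))"
      by (simp add: left_diff_distrib mult.assoc)
    also have "\<dots> = - 2 * fps_nth S m"
      using catalan_Suc[of "m - 1"] by (cases m) (auto simp: S0 SSuc c0 algebra_simps)
    finally show "fps_nth ((1 - fps_const 4 * fps_X) * fps_deriv S) m = fps_nth (- fps_const 2 * S) m"
      by simp
  qed
  have "(1 - fps_const 4 * fps_X) * fps_deriv G = fps_const 2 * (S * ((1 - fps_const 4 * fps_X) * fps_deriv S))"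
    by (simp add: G_def flip: numeral_fps_const)
  also have "\<dots> = - fps_const 4 * G"
    unfolding S' G_def by (simp add: algebra_simps)
  finally have G': "(1 - fps_const 4 * fps_X) * fps_deriv G = - fps_const 4 * G" .
  have rec: "real (m + 1) * fps_nth G (m + 1) = (4 * real m - 4) * fps_nth G m" for m
  proof -
    have "fps_nth ((1 - fps_const 4 * fps_X) * fps_deriv G) m
      = fps_nth (fps_deriv G) m - 4 * (if m = 0 then 0 else fps_nth (fps_deriv G) (m - 1))"
      by (simp add: left_diff_distrib mult.assoc)
    moreover have "fps_nth (- fps_const 4 * G) m = - 4 * fps_nth G m" by simp
    ultimately show ?thesis unfolding G' by (cases m) (simp_all add: algebra_simps)
  qed
  \<comment> \<open>At \<open>m = 1\<close> the factor \<open>4 * real m - 4\<close> in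
    \<open>rec\<close> is zero, which kills the quadratic coefficient; the recurrence then
    propagates the zero.\<close>
  have G2: "fps_nth G (m + 2) = 0" for m
  proof (induction m)
    case 0 then show ?case using rec[of 1] by (simp add: numeral_2_eq_2)
  next
    case (Suc m) then show ?case using rec[of "m + 2"] by simp
  qed
  \<comment> \<open>Expanding the square gives \<open>G\<close> as \<open>1 - 4XC + 4X^2C^2\<close>;
    the vanishing of this coefficient is the convolution identity.\<close>
  have "fps_nth G (n + 2) = 4 * (\<Sum>i\<le>n. catalan i * catalan (n - i)) - 4 * catalan (Suc n)"
  proof -
    have "G = 1 - fps_const 4 * (fps_X * C) + fps_const 4 * (fps_X * (fps_X * (C * C)))"
      unfolding G_def S_def by (simp add: algebra_simps) (simp flip: numeral_fps_const)
    then have "fps_nth G (n + 2) = 4 * fps_nth (C * C) n - 4 * fps_nth C (Suc n)" by simp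
    then show ?thesis by (simp add: C_def fps_mult_nth atMost_atLeast0)
  qed
  then show ?thesis using G2[of n] by simp
qed

lemma card_avoiders231_interval: "real (card (avoiders231 {l..<l + n})) = catalan n"
proof (induction n arbitrary: l rule: less_induct)
  case (less n)
  show ?case
  proof (cases n)
    case 0
    have "avoiders231 {} = {[]}" by (auto simp: avoiders231_iff)
    then show ?thesis using 0 by (simp add: catalan_def)
  next
    case (Suc m)
    let ?f = "\<lambda>i (xs, ys). (l + i) # xs @ ys"
    let ?A = "\<lambda>i. avoiders231 {l..<l + i} \<times> avoiders231 {Suc (l + i)..<Suc (l + i) + (m - i)}"
    \<comment> \<open>The cut between \<open>xs\<close> and \<open>ys\<close> can be recovered
      because \<open>xs\<close> always has length \<open>i\<close>.\<close>
    have "inj_on (?f i) (?A i)" for i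
    proof -
      have "length xs = card {l..<l + i}" if "xs \<in> avoiders231 {l..<l + i}" for xs
        using that by (metis avoiders231_iff distinct_card)
      then show ?thesis by (fastforce simp: inj_on_def)
    qed
    then have "card (?f i ` ?A i) =
      card (avoiders231 {l..<l + i}) * card (avoiders231 {Suc (l + i)..<Suc (l + i) + (m - i)})" for i
      by (simp add: card_image card_cartesian_product)
    \<comment> \<open>The pieces are disjoint because the first entry \<open>l + i\<close> reveals
      \<open>i\<close>.\<close>
    moreover have "card (\<Union>i\<le>m. ?f i ` ?A i) = (\<Sum>i\<le>m. card (?f i ` ?A i))"
      by (rule card_UN_disjoint) (auto simp: finite_avoiders231)
    ultimately have "card (avoiders231 {l..<l + n}) = (\<Sum>i\<le>m.
      card (avoiders231 {l..<l + i}) * card (avoiders231 {Suc (l + i)..<Suc (l + i) + (m - i)}))"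
      by (simp only: Suc avoiders231_interval_Suc)
    then have "real (card (avoiders231 {l..<l + n})) = (\<Sum>i\<le>m.
      real (card (avoiders231 {l..<l + i})) * real (card (avoiders231 {Suc (l + i)..<Suc (l + i) + (m - i)})))"
      by (simp only: of_nat_sum of_nat_mult)
    also have "\<dots> = (\<Sum>i\<le>m. catalan i * catalan (m - i))"
      by (intro sum.cong refl arg_cong2[of _ _ _ _ "(*)"] less.IH) (auto simp: Suc)
    finally show ?thesis using Suc catalan_convolution by simp
  qed
qed

lemma card_avoiders231: "real (card (avoiders231 {1..n})) = catalan n"
  using card_avoiders231_interval[of 1 n] by (simp add: atLeastLessThanSuc_atLeastAtMost)

section \<open>Rotations avoiding 231\<close>

text \<open>The list \<open>n, n - 1, ..., m + 1\<close>. The index \<open>m\<close> counts the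
  values left out at the bottom, so a permutation of \<open>{1..m}\<close> in front of it completes
  it to one of \<open>{1..n}\<close>.\<close>

definition descending :: "nat \<Rightarrow> nat \<Rightarrow> nat list" where
  "descending m n = rev [Suc m..<Suc n]"

lemma set_descending: "set (descending m n) = {m<..n}"
  by (auto simp: descending_def)

lemma distinct_descending: "distinct (descending m n)"
  by (simp add: descending_def)

lemma sorted_descending: "sorted_wrt (>) (descending m n)"
  by (simp add: descending_def sorted_wrt_rev del: upt_Suc)

lemma descending_snoc: "m < n \<Longrightarrow> descending m n = descending (Suc m) n @ [Suc m]"
  by (simp add: descending_def upt_conv_Cons del: upt_Suc)

lemma descending_pred: "0 < b \<Longrightarrow> b \<le> n \<Longrightarrow> descending (b - 1) n = descending b n @ [b]"
  using descending_snoc[of "b - 1" n] by simp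

lemma descending_Cons: "m < n \<Longrightarrow> descending m n = n # descending m (n - 1)"
  by (cases n) (auto simp: descending_def)

lemma descending_empty: "descending n n = []"
  by (simp add: descending_def)

lemma descending_unique:
  assumes "sorted_wrt (>) xs" "set xs = {m<..n}"
  shows "xs = descending m n"
proof -
  have "rev xs = rev (descending m n)"
    by (rule strict_sorted_equal)
      (use assms sorted_descending in \<open>auto simp: sorted_wrt_rev set_descending\<close>)
  then show ?thesis by simp
qed

lemma append_descending_avoiders231:
  assumes "t \<in> avoiders231 {1..m}" "m \<le> n"
  shows "t @ descending m n \<in> avoiders231 {1..n}"
proof -
  have "avoids231 (t @ descending m n)"
    using assms avoids231_decreasing[OF sorted_descending]
    by (subst avoids231_append) (auto simp: avoiders231_iff set_descending)
  moreover have t: "set t = {1..m}" "distinct t"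
    using assms(1) by (simp_all add: avoiders231_iff)
  moreover have "{1..m} \<union> {m<..n} = {1..n}"
    using assms(2) by (intro set_eqI) (simp, linarith)
  moreover have "{1..m} \<inter> {m<..n} = {}"
    by (intro set_eqI) simp
  ultimately show ?thesis
    by (simp only: avoiders231_iff set_append distinct_append set_descending distinct_descending)
qed

lemma descending_avoiders231: "descending 0 n \<in> avoiders231 {1..n}"
  using append_descending_avoiders231[of "[]" 0 n] by (auto simp: avoiders231_iff)

text \<open>A maximum in front could only play the \<open>2\<close>, which needs a larger entry.
  This provides the preimages under \<open>rotate1\<close>.\<close>

lemma Cons_avoiders231:
  assumes "t \<in> avoiders231 {1..m}"
  shows "Suc m # t \<in> avoiders231 {1..Suc m}"
proof -
  have "sorted_wrt (\<lambda>y z. Suc m < y \<longrightarrow> Suc m < z) t"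
    unfolding sorted_wrt_iff_nth_less
  proof (intro allI impI)
    fix i j assume ij: "i < j" "j < length t" "Suc m < t ! i"
    have "t ! i \<in> {1..m}" using assms ij nth_mem[of i t] by (simp add: avoiders231_iff)
    then show "Suc m < t ! j" using ij by simp
  qed
  moreover have "set t = {1..m}" "distinct t" "avoids231 t"
    using assms by (simp_all add: avoiders231_iff)
  moreover have "insert (Suc m) {1..m} = {1..Suc m}"
    by (simp add: atLeastAtMostSuc_conv)
  ultimately show ?thesis by (simp add: avoiders231_iff)
qed

text \<open>With \<open>b\<close> in front, the entries below \<open>b\<close> must precede those
  above it. With \<open>b\<close> at the end, an ascent among the entries above \<open>b\<close>
  would complete a 231, so these entries decrease.\<close>

lemma rotate1_avoiders231:
  assumes "b # xs \<in> avoiders231 {1..n}" "xs @ [b] \<in> avoiders231 {1..n}"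
  obtains t where "b \<in> {1..n}" "t \<in> avoiders231 {1..b - 1}" "xs = t @ descending b n"
proof -
  have b: "b \<in> {1..n}" "b \<notin> set xs" "insert b (set xs) = {1..n}" "distinct xs" "avoids231 (b # xs)"
    "sorted_wrt (\<lambda>x y. x < y \<longrightarrow> x < b) xs"
    using assms by (auto simp: avoiders231_iff avoids231_snoc)
  obtain L R where xs: "xs = L @ R" and L: "\<And>y. y \<in> set L \<Longrightarrow> y < b" and R: "\<And>y. y \<in> set R \<Longrightarrow> b < y"
    using avoids231_Cons_split b(2,5) by blast
  have un: "set L \<union> set R = {1..n} - {b}" using b xs by auto
  have sL: "set L = {y \<in> set L \<union> set R. y < b}" and sR: "set R = {y \<in> set L \<union> set R. b < y}"
    using L R by (auto dest: less_asym)
  have sL: "set L = {1..b - 1}"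
    using b(1) by (subst sL) (auto simp: un)
  have sR: "set R = {b<..n}"
    using b(1) by (subst sR) (auto simp: un)
  have "sorted_wrt (>) R"
    unfolding sorted_wrt_iff_nth_less
  proof (intro allI impI)
    fix i j assume ij: "i < j" "j < length R"
    have "sorted_wrt (\<lambda>x y. x < y \<longrightarrow> x < b) R" using b(6) xs by (simp add: sorted_wrt_append)
    then have "R ! i < R ! j \<longrightarrow> R ! i < b" using ij by (simp add: sorted_wrt_iff_nth_less)
    moreover have "b < R ! i" using R ij by simp
    moreover have "R ! i \<noteq> R ! j" using b(4) xs ij by (simp add: nth_eq_iff_index_eq)
    ultimately show "R ! i > R ! j" by simp
  qed
  then have "R = descending b n" using sR by (rule descending_unique)
  moreover have "L \<in> avoiders231 {1..b - 1}"
  proof -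
    have "avoids231 (L @ R)" using b(5) xs by simp
    moreover have "x < y" if "x \<in> set L" "y \<in> set R" for x y
      using L[OF that(1)] R[OF that(2)] by (rule less_trans)
    ultimately have "avoids231 L" using avoids231_append[of L R] by blast
    then show ?thesis using sL b(4) xs by (simp add: avoiders231_iff)
  qed
  ultimately show ?thesis using that b(1) xs by blast
qed

text \<open>The second family consists of rotations of the decreasing permutation. Its range leaves
  out the values of \<open>b\<close> that repeat the first family: \<open>b\<close> up to
  \<open>n - k + 1\<close>, where \<open>t\<close> is \<open>descending 0 b\<close>, and
  \<open>b = n\<close>, which is the case \<open>m = 0\<close>.\<close>

definition final_rotations :: "nat \<Rightarrow> nat \<Rightarrow> nat list set" where
  "final_rotations n k = (\<Union>m\<le>n - k + 1. (\<lambda>t. t @ descending m n) ` avoiders231 {1..m}) \<union>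
     (\<lambda>b. descending 0 b @ descending b n) ` {n - k + 2..<n}"

text \<open>The additional condition concerns \<open>rotate k p\<close> alone, so on the level of
  images it is a mere intersection. This makes an induction on \<open>k\<close> possible.\<close>

lemma rotation_avoiders_Suc:
  "rotate k ` rotation_avoiders n (Suc k) [2, 3, 1] =
     rotate k ` rotation_avoiders n k [2, 3, 1] \<inter> avoiders231 {1..n}"
proof -
  have "rotation_avoiders n (Suc k) [2, 3, 1] =
    {p \<in> rotation_avoiders n k [2, 3, 1]. rotate k p \<in> avoiders231 {1..n}}"
    by (auto simp: rotation_avoiders_iff avoids_pattern_231 avoiders231_iff permutations_of_set_def
        less_Suc_eq simp del: One_nat_def)
  then show ?thesis by blast
qed

lemma final_rotations_2:
  assumes "2 \<le> n"
  shows "rotate1 ` avoiders231 {1..n} \<inter> avoiders231 {1..n} = final_rotations n 2"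
proof (intro set_eqI iffI)
  fix q assume q: "q \<in> rotate1 ` avoiders231 {1..n} \<inter> avoiders231 {1..n}"
  then obtain p where p: "p \<in> avoiders231 {1..n}" "q = rotate1 p" by blast
  then obtain b xs where pb: "p = b # xs" using assms by (cases p) (auto simp: avoiders231_iff)
  obtain t where t: "b \<in> {1..n}" "t \<in> avoiders231 {1..b - 1}" "xs = t @ descending b n"
    using rotate1_avoiders231[of b xs n] p pb q by auto
  have "q = t @ descending (b - 1) n"
    using p pb t descending_pred[of b n] by simp
  then show "q \<in> final_rotations n 2"
    using t unfolding final_rotations_def by (auto intro!: bexI[of _ "b - 1"])
next
  fix q assume "q \<in> final_rotations n 2"
  \<comment> \<open>For \<open>k = 2\<close> the second family is empty, its range being
    \<open>{n..<n}\<close>.\<close>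
  then obtain m t where "m \<le> n - 2 + 1" and t: "t \<in> avoiders231 {1..m}" "q = t @ descending m n"
    using assms by (auto simp: final_rotations_def)
  then have m: "m < n" using assms by linarith
  note m = m t
  have "q = rotate1 ((Suc m # t) @ descending (Suc m) n)"
    using m descending_snoc[of m n] by simp
  moreover have "(Suc m # t) @ descending (Suc m) n \<in> avoiders231 {1..n}"
    using m Cons_avoiders231 append_descending_avoiders231 by (metis Suc_leI)
  moreover have "q \<in> avoiders231 {1..n}"
    using m append_descending_avoiders231[of t m n] by simp
  ultimately show "q \<in> rotate1 ` avoiders231 {1..n} \<inter> avoiders231 {1..n}" by blast
qed

text \<open>A further rotation lowers the index by one: a list with nonempty \<open>t\<close>
  survives only if \<open>t\<close> starts with its maximum \<open>m\<close>, and \<open>b\<close>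
  becomes \<open>b - 1\<close> in the second family. The decreasing permutation,
  \<open>m = 0\<close>, moves to the second family with \<open>b = n - 1\<close>.\<close>

lemma final_rotations_Suc:
  assumes "2 \<le> k" "k < n"
  shows "rotate1 ` final_rotations n k \<inter> avoiders231 {1..n} = final_rotations n (Suc k)"
proof (intro set_eqI iffI)
  fix q assume "q \<in> rotate1 ` final_rotations n k \<inter> avoiders231 {1..n}"
  then obtain p where p: "p \<in> final_rotations n k" "q = rotate1 p" and q: "q \<in> avoiders231 {1..n}"
    by blast
  from p(1) consider (main) m s where "m \<le> n - k + 1" "s \<in> avoiders231 {1..m}" "p = s @ descending m n"
    | (extra) b where "b \<in> {n - k + 2..<n}" "p = descending 0 b @ descending b n"
    unfolding final_rotations_def by auto
  then show "q \<in> final_rotations n (Suc k)"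
  proof cases
    case main
    show ?thesis
    proof (cases s)
      case Nil
      then have "m = 0" using main(2) by (auto simp: avoiders231_iff)
      then have "q = descending 0 (n - 1) @ descending (n - 1) n"
        using p main Nil assms descending_Cons[of 0 n] descending_pred[of n n]
        by (simp add: descending_empty)
      moreover have "n - 1 \<in> {n - Suc k + 2..<n}" using assms by auto
      ultimately show ?thesis unfolding final_rotations_def by blast
    next
      case (Cons b s')
      have "p \<in> avoiders231 {1..n}"
        using append_descending_avoiders231[OF main(2)] main assms by simp
      then obtain t where t: "b \<in> {1..n}" "t \<in> avoiders231 {1..b - 1}"
        "s' @ descending m n = t @ descending b n"
        using rotate1_avoiders231[of b "s' @ descending m n" n] main Cons p q by auto
      have "b \<le> m" using main(2) Cons by (auto simp: avoiders231_iff)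
      moreover have "m < n" using main assms by linarith
      \<comment> \<open>Both runs are nonempty, so the last entries of the two sides are
        \<open>Suc m\<close> and \<open>Suc b\<close>.\<close>
      ultimately have "Suc m = Suc b"
        using arg_cong[OF t(3), of last] descending_snoc[of m n] descending_snoc[of b n] by simp
      then have "b = m" by simp
      have "q = t @ descending (b - 1) n"
        using p main Cons t descending_pred[of b n] by simp
      moreover have "b - 1 \<le> n - Suc k + 1" using \<open>b = m\<close> main assms by linarith
      ultimately show ?thesis using t(2) unfolding final_rotations_def by auto
    qed
  next
    case extra
    then have "q = descending 0 (b - 1) @ descending (b - 1) n"
      using p descending_Cons[of 0 b] descending_pred[of b n] by auto
    moreover have "b - 1 \<in> {n - Suc k + 2..<n}" using extra assms by auto
    ultimately show ?thesis unfolding final_rotations_def by blast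
  qed
next
  fix q assume "q \<in> final_rotations n (Suc k)"
  then consider (main) m t where "m \<le> n - k" "t \<in> avoiders231 {1..m}" "q = t @ descending m n"
    | (extra) b where "b \<in> {n - k + 1..<n}" "q = descending 0 b @ descending b n"
    unfolding final_rotations_def using assms by (auto simp: Suc_diff_Suc)
  then show "q \<in> rotate1 ` final_rotations n k \<inter> avoiders231 {1..n}"
  proof cases
    case main
    then have "m < n" using assms by simp
    then have "q = rotate1 ((Suc m # t) @ descending (Suc m) n)"
      using main descending_snoc[of m n] by simp
    moreover have "(Suc m # t) @ descending (Suc m) n \<in> final_rotations n k"
      using Cons_avoiders231[OF main(2)] main(1) unfolding final_rotations_def
      by (intro UnI1 UN_I[of "Suc m"] imageI) auto
    moreover have "q \<in> avoiders231 {1..n}"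
      using main \<open>m < n\<close> append_descending_avoiders231[of t m n] by simp
    ultimately show ?thesis by blast
  next
    case extra
    have "q \<in> avoiders231 {1..n}"
      using extra append_descending_avoiders231[OF descending_avoiders231, of b n] by simp
    moreover have "q \<in> rotate1 ` final_rotations n k"
    \<comment> \<open>Undoing the rotation raises \<open>b\<close> by one; at
      \<open>Suc b = n\<close> this gives the decreasing permutation, found in the first
      family.\<close>
    proof (cases "Suc b = n")
      case True
      then have "q = rotate1 ([] @ descending 0 n)"
        using extra descending_Cons[of 0 n] descending_snoc[of b n] by (auto simp: descending_empty)
      moreover have "[] @ descending 0 n \<in> final_rotations n k"
        unfolding final_rotations_def
        by (intro UnI1 UN_I[of 0] imageI) (auto simp: avoiders231_iff)
      ultimately show ?thesis by blast
    next
      case False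
      then have "q = rotate1 (descending 0 (Suc b) @ descending (Suc b) n)"
        using extra descending_Cons[of 0 "Suc b"] descending_snoc[of b n] by auto
      moreover have "Suc b \<in> {n - k + 2..<n}" using extra False by auto
      ultimately show ?thesis unfolding final_rotations_def by blast
    qed
    ultimately show ?thesis by blast
  qed
qed

text \<open>Induction from \<open>k = 2\<close>, where a single rotation is imposed on all
  231-avoiders. Tracking the last rotation instead of \<open>p\<close> itself makes each step one
  more \<open>rotate1\<close>.\<close>

lemma rotate_rotation_avoiders:
  assumes "2 \<le> k" "k \<le> n"
  shows "rotate (k - 1) ` rotation_avoiders n k [2, 3, 1] = final_rotations n k"
  using assms
proof (induction k rule: dec_induct)
  case base
  have "rotation_avoiders n 1 [2, 3, 1] = avoiders231 {1..n}"
    by (auto simp: rotation_avoiders_iff avoids_pattern_231 avoiders231_def simp del: One_nat_def)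
  then show ?case
    using rotation_avoiders_Suc[of 1 n] final_rotations_2[of n] base
    by (simp add: numeral_2_eq_2)
next
  case (step k)
  have "rotate k ` rotation_avoiders n k [2, 3, 1] =
    rotate1 ` rotate (k - 1) ` rotation_avoiders n k [2, 3, 1]"
    using step.hyps(1) by (cases k) (simp_all add: image_image)
  then show ?case
    using step rotation_avoiders_Suc[of k n] final_rotations_Suc[of k n] by simp
qed

section \<open>Counting the final rotations\<close>

lemma card_final_rotations:
  assumes "2 \<le> k" "k \<le> n"
  shows "real (card (final_rotations n k)) = real k - 2 + (\<Sum>i = 0..n - k + 1. catalan i)"
proof -
  let ?M = "\<lambda>m. (\<lambda>t. t @ descending m n) ` avoiders231 {1..m}"
  let ?E = "(\<lambda>b. descending 0 b @ descending b n) ` {n - k + 2..<n}"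
  \<comment> \<open>The last entry recovers \<open>m\<close> or \<open>b\<close>. This separates the
    pieces of the first family, makes the second one injective, and keeps the two families
    apart.\<close>
  have last: "last (t @ descending m n) = Suc m" if "m < n" for t m
    using descending_snoc[OF that] by simp
  have bound: "m < n" if "m \<le> n - k + 1" for m using that assms by linarith
  have "card (\<Union>m\<le>n - k + 1. ?M m) = (\<Sum>m\<le>n - k + 1. card (?M m))"
  proof (rule card_UN_disjoint)
    show "\<forall>i\<in>{..n - k + 1}. \<forall>j\<in>{..n - k + 1}. i \<noteq> j \<longrightarrow> ?M i \<inter> ?M j = {}"
    proof (intro ballI impI)
      fix i j assume "i \<in> {..n - k + 1}" "j \<in> {..n - k + 1}" "i \<noteq> j"
      then have "i < n" "j < n" using bound by auto
      with \<open>i \<noteq> j\<close> show "?M i \<inter> ?M j = {}"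
        using last by (metis (no_types, lifting) disjoint_iff imageE nat.inject)
    qed
  qed (auto simp: finite_avoiders231)
  also have "\<dots> = (\<Sum>m = 0..n - k + 1. card (avoiders231 {1..m}))"
    by (simp add: atMost_atLeast0 card_image inj_on_def)
  finally have main: "real (card (\<Union>m\<le>n - k + 1. ?M m)) = (\<Sum>i = 0..n - k + 1. catalan i)"
    by (simp only: of_nat_sum card_avoiders231)
  have "inj_on (\<lambda>b. descending 0 b @ descending b n) {n - k + 2..<n}"
    by (rule inj_onI) (metis last atLeastLessThan_iff nat.inject)
  then have extra: "card ?E = k - 2" using assms by (simp add: card_image)
  have "(\<Union>m\<le>n - k + 1. ?M m) \<inter> ?E = {}"
  proof -
    have False if "m \<le> n - k + 1" "b \<in> {n - k + 2..<n}" "t @ descending m n = descending 0 b @ descending b n"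
      for m b t
    proof -
      have "Suc m = Suc b" using that last[of m t] last[of b "descending 0 b"] bound by simp
      then show False using that by simp
    qed
    then show ?thesis by blast
  qed
  then have "card (final_rotations n k) = card (\<Union>m\<le>n - k + 1. ?M m) + card ?E"
    unfolding final_rotations_def by (intro card_Un_disjoint) (auto simp: finite_avoiders231)
  then show ?thesis using main extra assms by simp
qed

theorem theorem3p2:
  fixes k n :: nat
  assumes "2 \<le> k" and "k \<le> n"
  shows "card (rotation_avoiders n k [2, 1, 3]) = card (rotation_avoiders n k [2, 3, 1]) \<and>
    card (rotation_avoiders n k [2, 3, 1]) = card (rotation_avoiders n k [3, 1, 2]) \<and>
    card (rotation_avoiders n k [3, 1, 2]) = card (rotation_avoiders n k [1, 3, 2]) \<and>
    real (card (rotation_avoiders n k [1, 3, 2])) =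
      real k - 2 + (\<Sum>i = 0..n - k + 1. catalan i)"
proof -
  \<comment> \<open>Rotation is injective, so the avoiders are as many as their last
    rotations.\<close>
  have "card (rotation_avoiders n k [2, 3, 1]) = card (final_rotations n k)"
    using rotate_rotation_avoiders[OF assms] card_image[OF inj_on_subset[OF inj_rotate]]
    by (metis subset_UNIV)
  moreover have "card (rotation_avoiders n k [1, 3, 2]) = card (rotation_avoiders n k [2, 3, 1])"
    using card_rotation_avoiders_rev[of "[2, 3, 1]" n k] by simp
  \<comment> \<open>Subtraction from 4 complements patterns of length 3: it takes 231 to 213 and,
    below, 132 to 312.\<close>
  moreover have "card (rotation_avoiders n k [2, 1, 3]) = card (rotation_avoiders n k [2, 3, 1])"
    using card_rotation_avoiders_complement[of "[2, 3, 1]" 4 n k] by simp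
  moreover have "card (rotation_avoiders n k [3, 1, 2]) = card (rotation_avoiders n k [1, 3, 2])"
    using card_rotation_avoiders_complement[of "[1, 3, 2]" 4 n k] by simp
  ultimately show ?thesis using card_final_rotations[OF assms] by simp
qed

end
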